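(* The theory $Q^\backsim$ strengthens $R^\backsim$ in the first-order logic $\mathrm{QSL}_w$, i.e. $Q^\backsim\vdash_{\mathrm{QSL}_w}\varphi$ for every axiom $\varphi$ of $R^\backsim$.
   Context: Propositional logic $\mathrm{SL}_w$ in the language $\to,\wedge,\vee,\bot$ (with $\neg\varphi:=\varphi\to\bot$, $\varphi\leftrightarrow\psi:=(\varphi\to\psi)\wedge(\psi\to\varphi)$), given by axioms: $\varphi\to\varphi$; $(\varphi\wedge\psi)\to\varphi$; $(\varphi\wedge\psi)\to\psi$; $((\varphi\to\psi)\wedge(\varphi\to\chi))\to(\varphi\to\psi\wedge\chi)$; $\varphi\to(\varphi\vee\psi)$; $\psi\to(\varphi\vee\psi)$; $(\varphi\to\chi)\wedge(\psi\to\chi)\to(\varphi\vee\psi\to\chi)$; $\varphi\to(\psi\to\varphi)$; $\bot\to\varphi$; and rules: $\varphi,\varphi\to\psi\rhd\psi$; $\varphi,\psi\rhd\varphi\wedge\psi$; $\varphi\to\psi,\chi\to\theta\rhd(\psi\to\chi)\to(\varphi\to\theta)$; $\varphi\rhd(\varphi\to\psi)\to\psi$. $\mathrm{QSL}_w$ is the first-order logic axiomatised by all substitution instances (atoms replaced by first-order formulas) of the axioms/rules of $\mathrm{SL}_w$ plus: $(\forall x)\varphi(x)\to\varphi(t)$; $\varphi(t)\to(\exists x)\varphi(x)$; $\chi\to\psi\rhd\chi\to(\forall x)\psi$; $\psi\to\chi\rhd(\exists x)\psi\to\chi$ ($t$ substitutable for $x$, $x$ not free in $\chi$); $x=x$;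 $x=y\to y=x$; $x=y\to(y=z\to x=z)$; $x=y\to t(x)=t(y)$; $x=y\to(\varphi(x)\to\varphi(y))$. Write $t\neq s$ for $\neg(t=s)$. Arithmetical language: constant $\overline{0}$, unary $S$, binary $=,\leq$, ternary $A,M$; numerals $\overline{n}=S\cdots S(\overline{0})$ ($n$ times). $R^\backsim$: axioms $A(\overline{m},\overline{n},x)\leftrightarrow\overline{m+n}=x$; $M(\overline{m},\overline{n},x)\leftrightarrow\overline{m\cdot n}=x$; $\overline{m}\neq\overline{n}$ for $m\neq n$; $x\leq\overline{n}\leftrightarrow(x=\overline{0}\vee x=\overline{1}\vee\dots\vee x=\overline{n})$; $x\leq\overline{n}\vee\overline{n}\leq x$; $x\leq\overline{n}\vee\neg(x\leq\overline{n})$ (for all $m,n\in\mathbb{N}$). $Q^\backsim$: axioms $x=y\vee x\neq y$; $S(x)\neq\overline{0}$; $S(x)=S(y)\to x=y$; $x\neq\overline{0}\to(\exists y)(x=S(y))$; $A(x,\overline{0},y)\leftrightarrow x=y$; $A(x,S(y),z)\leftrightarrow(\exists u)(A(x,y,u)\wedge z=S(u))$; $M(x,\overline{0},y)\leftrightarrow y=\overline{0}$; $M(x,S(y),z)\to(\exists u)(M(x,y,u)\wedge A(u,x,z))$; $M(\overline{m},\overline{n},u)\to(A(u,\overline{n},x)\to M(\overline{m},\overline{n+1},x))$ for all $m,n$; $x\leq y\leftrightarrow(\exists z)A(z,x,y)$. *)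

theory Defs
  imports Main
begin

type_synonym var = nat

datatype tm = Var var | Zero | S tm

datatype fm =
    Bot ("\<^bold>\<bottom>")
  | Eq tm tm (infix "\<^bold>=" 60)
  | Le tm tm (infix "\<^bold>\<le>" 60)
  | A tm tm tm
  | M tm tm tm
  | Imp fm fm (infixr "\<^bold>\<rightarrow>" 45)
  | Conj fm fm (infixr "\<^bold>\<and>" 55)
  | Disj fm fm (infixr "\<^bold>\<or>" 50)
  | All var fm
  | Ex var fm

abbreviation Neg :: "fm \<Rightarrow> fm" ("\<^bold>\<not> _" [58] 58) where
  "\<^bold>\<not> \<phi> \<equiv> \<phi> \<^bold>\<rightarrow> \<^bold>\<bottom>"

abbreviation Iff :: "fm \<Rightarrow> fm \<Rightarrow> fm" (infix "\<^bold>\<leftrightarrow>" 44) where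
  "\<phi> \<^bold>\<leftrightarrow> \<psi> \<equiv> (\<phi> \<^bold>\<rightarrow> \<psi>) \<^bold>\<and> (\<psi> \<^bold>\<rightarrow> \<phi>)"

abbreviation Neq :: "tm \<Rightarrow> tm \<Rightarrow> fm" (infix "\<^bold>\<noteq>" 60) where
  "t \<^bold>\<noteq> s \<equiv> \<^bold>\<not> (t \<^bold>= s)"

primrec tvars :: "tm \<Rightarrow> var set" where
  "tvars (Var x) = {x}"
| "tvars Zero = {}"
| "tvars (S t) = tvars t"

primrec fv :: "fm \<Rightarrow> var set" where
  "fv \<^bold>\<bottom> = {}"
| "fv (t \<^bold>= s) = tvars t \<union> tvars s"
| "fv (t \<^bold>\<le> s) = tvars t \<union> tvars s"
| "fv (A r s t) = tvars r \<union> tvars s \<union> tvars t"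
| "fv (M r s t) = tvars r \<union> tvars s \<union> tvars t"
| "fv (\<phi> \<^bold>\<rightarrow> \<psi>) = fv \<phi> \<union> fv \<psi>"
| "fv (\<phi> \<^bold>\<and> \<psi>) = fv \<phi> \<union> fv \<psi>"
| "fv (\<phi> \<^bold>\<or> \<psi>) = fv \<phi> \<union> fv \<psi>"
| "fv (All y \<phi>) = fv \<phi> - {y}"
| "fv (Ex y \<phi>) = fv \<phi> - {y}"

primrec tsubst :: "var \<Rightarrow> tm \<Rightarrow> tm \<Rightarrow> tm" where
  "tsubst x t (Var y) = (if y = x then t else Var y)"
| "tsubst x t Zero = Zero"
| "tsubst x t (S s) = S (tsubst x t s)"

text \<open>\<open>subst x t \<phi>\<close> replaces the free occurrences of \<open>x\<close> in \<open>\<phi>\<close> by \<open>t\<close> without renaming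
  bound variables, so it is only meaningful under \<open>substitutable t x \<phi>\<close>.\<close>

primrec subst :: "var \<Rightarrow> tm \<Rightarrow> fm \<Rightarrow> fm" where
  "subst x t \<^bold>\<bottom> = \<^bold>\<bottom>"
| "subst x t (r \<^bold>= s) = (tsubst x t r \<^bold>= tsubst x t s)"
| "subst x t (r \<^bold>\<le> s) = (tsubst x t r \<^bold>\<le> tsubst x t s)"
| "subst x t (A p q r) = A (tsubst x t p) (tsubst x t q) (tsubst x t r)"
| "subst x t (M p q r) = M (tsubst x t p) (tsubst x t q) (tsubst x t r)"
| "subst x t (\<phi> \<^bold>\<rightarrow> \<psi>) = (subst x t \<phi> \<^bold>\<rightarrow> subst x t \<psi>)"
| "subst x t (\<phi> \<^bold>\<and> \<psi>) = (subst x t \<phi> \<^bold>\<and> subst x t \<psi>)"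
| "subst x t (\<phi> \<^bold>\<or> \<psi>) = (subst x t \<phi> \<^bold>\<or> subst x t \<psi>)"
| "subst x t (All y \<phi>) = (if y = x then All y \<phi> else All y (subst x t \<phi>))"
| "subst x t (Ex y \<phi>) = (if y = x then Ex y \<phi> else Ex y (subst x t \<phi>))"

primrec substitutable :: "tm \<Rightarrow> var \<Rightarrow> fm \<Rightarrow> bool" where
  "substitutable t x \<^bold>\<bottom> = True"
| "substitutable t x (r \<^bold>= s) = True"
| "substitutable t x (r \<^bold>\<le> s) = True"
| "substitutable t x (A p q r) = True"
| "substitutable t x (M p q r) = True"
| "substitutable t x (\<phi> \<^bold>\<rightarrow> \<psi>) = (substitutable t x \<phi> \<and> substitutable t x \<psi>)"
| "substitutable t x (\<phi> \<^bold>\<and> \<psi>) = (substitutable t x \<phi> \<and> substitutable t x \<psi>)"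
| "substitutable t x (\<phi> \<^bold>\<or> \<psi>) = (substitutable t x \<phi> \<and> substitutable t x \<psi>)"
| "substitutable t x (All y \<phi>) =
    (x \<notin> fv (All y \<phi>) \<or> (y \<notin> tvars t \<and> substitutable t x \<phi>))"
| "substitutable t x (Ex y \<phi>) =
    (x \<notin> fv (Ex y \<phi>) \<or> (y \<notin> tvars t \<and> substitutable t x \<phi>))"

text \<open>Derivability from a set \<open>T\<close> of possibly open formulas in \<open>QSL\<^sub>w\<close>. All rules apply to
  arbitrary consequences of \<open>T\<close>. The rules up to \<open>assertion\<close> are the first-order instances of
  \<open>SL\<^sub>w\<close>; as its axioms are schemata, their substitution instances are the schemata over \<open>fm\<close>.\<close>

inductive QSLw :: "fm set \<Rightarrow> fm \<Rightarrow> bool" (infix "\<turnstile>\<^sub>Q\<^sub>S\<^sub>L\<^sub>w" 40) for T :: "fm set" where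
  hyp: "\<phi> \<in> T \<Longrightarrow> T \<turnstile>\<^sub>Q\<^sub>S\<^sub>L\<^sub>w \<phi>"
| ident: "T \<turnstile>\<^sub>Q\<^sub>S\<^sub>L\<^sub>w \<phi> \<^bold>\<rightarrow> \<phi>"
| conjE1: "T \<turnstile>\<^sub>Q\<^sub>S\<^sub>L\<^sub>w (\<phi> \<^bold>\<and> \<psi>) \<^bold>\<rightarrow> \<phi>"
| conjE2: "T \<turnstile>\<^sub>Q\<^sub>S\<^sub>L\<^sub>w (\<phi> \<^bold>\<and> \<psi>) \<^bold>\<rightarrow> \<psi>"
| conj_imp: "T \<turnstile>\<^sub>Q\<^sub>S\<^sub>L\<^sub>w ((\<phi> \<^bold>\<rightarrow> \<psi>) \<^bold>\<and> (\<phi> \<^bold>\<rightarrow> \<chi>)) \<^bold>\<rightarrow> (\<phi> \<^bold>\<rightarrow> (\<psi> \<^bold>\<and> \<chi>))"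
| disjI1: "T \<turnstile>\<^sub>Q\<^sub>S\<^sub>L\<^sub>w \<phi> \<^bold>\<rightarrow> (\<phi> \<^bold>\<or> \<psi>)"
| disjI2: "T \<turnstile>\<^sub>Q\<^sub>S\<^sub>L\<^sub>w \<psi> \<^bold>\<rightarrow> (\<phi> \<^bold>\<or> \<psi>)"
| disj_imp: "T \<turnstile>\<^sub>Q\<^sub>S\<^sub>L\<^sub>w ((\<phi> \<^bold>\<rightarrow> \<chi>) \<^bold>\<and> (\<psi> \<^bold>\<rightarrow> \<chi>)) \<^bold>\<rightarrow> ((\<phi> \<^bold>\<or> \<psi>) \<^bold>\<rightarrow> \<chi>)"
| weak: "T \<turnstile>\<^sub>Q\<^sub>S\<^sub>L\<^sub>w \<phi> \<^bold>\<rightarrow> (\<psi> \<^bold>\<rightarrow> \<phi>)"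
| bot: "T \<turnstile>\<^sub>Q\<^sub>S\<^sub>L\<^sub>w \<^bold>\<bottom> \<^bold>\<rightarrow> \<phi>"
| mp: "T \<turnstile>\<^sub>Q\<^sub>S\<^sub>L\<^sub>w \<phi> \<Longrightarrow> T \<turnstile>\<^sub>Q\<^sub>S\<^sub>L\<^sub>w \<phi> \<^bold>\<rightarrow> \<psi> \<Longrightarrow> T \<turnstile>\<^sub>Q\<^sub>S\<^sub>L\<^sub>w \<psi>"
| adj: "T \<turnstile>\<^sub>Q\<^sub>S\<^sub>L\<^sub>w \<phi> \<Longrightarrow> T \<turnstile>\<^sub>Q\<^sub>S\<^sub>L\<^sub>w \<psi> \<Longrightarrow> T \<turnstile>\<^sub>Q\<^sub>S\<^sub>L\<^sub>w \<phi> \<^bold>\<and> \<psi>"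
| affix: "T \<turnstile>\<^sub>Q\<^sub>S\<^sub>L\<^sub>w \<phi> \<^bold>\<rightarrow> \<psi> \<Longrightarrow> T \<turnstile>\<^sub>Q\<^sub>S\<^sub>L\<^sub>w \<chi> \<^bold>\<rightarrow> \<theta> \<Longrightarrow>
    T \<turnstile>\<^sub>Q\<^sub>S\<^sub>L\<^sub>w (\<psi> \<^bold>\<rightarrow> \<chi>) \<^bold>\<rightarrow> (\<phi> \<^bold>\<rightarrow> \<theta>)"
| assertion: "T \<turnstile>\<^sub>Q\<^sub>S\<^sub>L\<^sub>w \<phi> \<Longrightarrow> T \<turnstile>\<^sub>Q\<^sub>S\<^sub>L\<^sub>w (\<phi> \<^bold>\<rightarrow> \<psi>) \<^bold>\<rightarrow> \<psi>"
| all_inst: "substitutable t x \<phi> \<Longrightarrow> T \<turnstile>\<^sub>Q\<^sub>S\<^sub>L\<^sub>w All x \<phi> \<^bold>\<rightarrow> subst x t \<phi>"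
| ex_inst: "substitutable t x \<phi> \<Longrightarrow> T \<turnstile>\<^sub>Q\<^sub>S\<^sub>L\<^sub>w subst x t \<phi> \<^bold>\<rightarrow> Ex x \<phi>"
| all_gen: "T \<turnstile>\<^sub>Q\<^sub>S\<^sub>L\<^sub>w \<chi> \<^bold>\<rightarrow> \<psi> \<Longrightarrow> x \<notin> fv \<chi> \<Longrightarrow> T \<turnstile>\<^sub>Q\<^sub>S\<^sub>L\<^sub>w \<chi> \<^bold>\<rightarrow> All x \<psi>"
| ex_gen: "T \<turnstile>\<^sub>Q\<^sub>S\<^sub>L\<^sub>w \<psi> \<^bold>\<rightarrow> \<chi> \<Longrightarrow> x \<notin> fv \<chi> \<Longrightarrow> T \<turnstile>\<^sub>Q\<^sub>S\<^sub>L\<^sub>w Ex x \<psi> \<^bold>\<rightarrow> \<chi>"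
| eq_refl: "T \<turnstile>\<^sub>Q\<^sub>S\<^sub>L\<^sub>w Var x \<^bold>= Var x"
| eq_sym: "T \<turnstile>\<^sub>Q\<^sub>S\<^sub>L\<^sub>w Var x \<^bold>= Var y \<^bold>\<rightarrow> Var y \<^bold>= Var x"
| eq_trans: "T \<turnstile>\<^sub>Q\<^sub>S\<^sub>L\<^sub>w Var x \<^bold>= Var y \<^bold>\<rightarrow> (Var y \<^bold>= Var z \<^bold>\<rightarrow> Var x \<^bold>= Var z)"
| eq_tm: "T \<turnstile>\<^sub>Q\<^sub>S\<^sub>L\<^sub>w Var x \<^bold>= Var y \<^bold>\<rightarrow> t \<^bold>= tsubst x (Var y) t"
| eq_fm: "substitutable (Var y) x \<phi> \<Longrightarrow>
    T \<turnstile>\<^sub>Q\<^sub>S\<^sub>L\<^sub>w Var x \<^bold>= Var y \<^bold>\<rightarrow> (\<phi> \<^bold>\<rightarrow> subst x (Var y) \<phi>)"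

primrec num :: "nat \<Rightarrow> tm" where
  "num 0 = Zero"
| "num (Suc n) = S (num n)"

text \<open>The free variables of the theories are four fixed distinct variables \<open>x\<close>, \<open>y\<close>, \<open>z\<close>, \<open>u\<close>.\<close>

abbreviation (input) vx :: var where "vx \<equiv> 0"
abbreviation (input) vy :: var where "vy \<equiv> 1"
abbreviation (input) vz :: var where "vz \<equiv> 2"
abbreviation (input) vu :: var where "vu \<equiv> 3"
abbreviation (input) X :: tm where "X \<equiv> Var vx"
abbreviation (input) Y :: tm where "Y \<equiv> Var vy"
abbreviation (input) Z :: tm where "Z \<equiv> Var vz"
abbreviation (input) U :: tm where "U \<equiv> Var vu"

primrec eq_some_upto :: "tm \<Rightarrow> nat \<Rightarrow> fm" where
  "eq_some_upto t 0 = (t \<^bold>= num 0)"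
| "eq_some_upto t (Suc n) = (eq_some_upto t n \<^bold>\<or> t \<^bold>= num (Suc n))"

definition R_sim :: "fm set" where
  "R_sim =
     {A (num m) (num n) X \<^bold>\<leftrightarrow> num (m + n) \<^bold>= X | m n. True}
   \<union> {M (num m) (num n) X \<^bold>\<leftrightarrow> num (m * n) \<^bold>= X | m n. True}
   \<union> {num m \<^bold>\<noteq> num n | m n. m \<noteq> n}
   \<union> {X \<^bold>\<le> num n \<^bold>\<leftrightarrow> eq_some_upto X n | n. True}
   \<union> {X \<^bold>\<le> num n \<^bold>\<or> num n \<^bold>\<le> X | n. True}
   \<union> {X \<^bold>\<le> num n \<^bold>\<or> \<^bold>\<not> (X \<^bold>\<le> num n) | n. True}"

text \<open>\<open>Q\<^sup>\<backsim>\<close> without its numeral-indexed axiom scheme for \<open>M\<close>.\<close>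

definition Q_sim_base :: "fm set" where
  "Q_sim_base = {
     X \<^bold>= Y \<^bold>\<or> X \<^bold>\<noteq> Y,
     S X \<^bold>\<noteq> Zero,
     S X \<^bold>= S Y \<^bold>\<rightarrow> X \<^bold>= Y,
     X \<^bold>\<noteq> Zero \<^bold>\<rightarrow> Ex vy (X \<^bold>= S Y),
     A X Zero Y \<^bold>\<leftrightarrow> X \<^bold>= Y,
     A X (S Y) Z \<^bold>\<leftrightarrow> Ex vu (A X Y U \<^bold>\<and> Z \<^bold>= S U),
     M X Zero Y \<^bold>\<leftrightarrow> Y \<^bold>= Zero,
     M X (S Y) Z \<^bold>\<rightarrow> Ex vu (M X Y U \<^bold>\<and> A U X Z),
     X \<^bold>\<le> Y \<^bold>\<leftrightarrow> Ex vz (A Z X Y)}"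

text \<open>The remaining scheme is printed with \<open>A(u, n, x)\<close>. Since \<open>m * (n + 1) = m * n + m\<close>, this is
  evidently a slip for \<open>A(u, m, x)\<close>: the printed instance \<open>m = 1\<close>, \<open>n = 0\<close> yields \<open>M(1, 1, 0)\<close>,
  which the recursion axiom for \<open>M\<close> refutes, so \<open>Q_sim_printed\<close> is inconsistent.
  \<open>Q_sim\<close> is the intended theory.\<close>

definition Q_sim_printed :: "fm set" where
  "Q_sim_printed = Q_sim_base \<union>
     {M (num m) (num n) U \<^bold>\<rightarrow> (A U (num n) X \<^bold>\<rightarrow> M (num m) (num (n + 1)) X) | m n. True}"

definition Q_sim :: "fm set" where
  "Q_sim = Q_sim_base \<union>
     {M (num m) (num n) U \<^bold>\<rightarrow> (A U (num m) X \<^bold>\<rightarrow> M (num m) (num (n + 1)) X) | m n. True}"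

end

theory Submission
  imports Defs
begin

text \<open>\<open>QSL\<^sub>w\<close> has neither exchange nor contraction nor a deduction theorem, but the assertion rule
  turns the replacement axiom \<open>s = t \<rightarrow> (\<phi>(s) \<rightarrow> \<phi>(t))\<close> into the rule \<open>\<phi>(s) \<rhd> s = t \<rightarrow> \<phi>(t)\<close>. Taking an
  implication for \<open>\<phi>\<close> avoids transferring hypotheses one at a time. Equality is decidable, which
  gives proofs by cases and lets a conjunction \<open>s = t \<and> \<psi>\<close> be used like the pair of successive
  hypotheses \<open>s = t\<close> and \<open>\<psi>\<close>. The axioms of \<open>R\<^sup>\<backsim>\<close> then follow by inductions on numerals. The
  multiplication scheme as printed yields \<open>M(1, 1, 0)\<close>, which the base theory refutes, so everything
  is derivable from it.\<close>

section \<open>Propositional rules\<close>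

lemma imp_trans [trans]:
  assumes "T \<turnstile>\<^sub>Q\<^sub>S\<^sub>L\<^sub>w \<phi> \<^bold>\<rightarrow> \<psi>" "T \<turnstile>\<^sub>Q\<^sub>S\<^sub>L\<^sub>w \<psi> \<^bold>\<rightarrow> \<chi>"
  shows "T \<turnstile>\<^sub>Q\<^sub>S\<^sub>L\<^sub>w \<phi> \<^bold>\<rightarrow> \<chi>"
  using mp[OF assms(2) affix[OF assms(1) ident]] .

lemma imp_weaken: "T \<turnstile>\<^sub>Q\<^sub>S\<^sub>L\<^sub>w \<psi> \<Longrightarrow> T \<turnstile>\<^sub>Q\<^sub>S\<^sub>L\<^sub>w \<phi> \<^bold>\<rightarrow> \<psi>"
  using mp weak by blast

lemma imp_conjI:
  assumes "T \<turnstile>\<^sub>Q\<^sub>S\<^sub>L\<^sub>w \<phi> \<^bold>\<rightarrow> \<psi>" "T \<turnstile>\<^sub>Q\<^sub>S\<^sub>L\<^sub>w \<phi> \<^bold>\<rightarrow> \<chi>"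
  shows "T \<turnstile>\<^sub>Q\<^sub>S\<^sub>L\<^sub>w \<phi> \<^bold>\<rightarrow> (\<psi> \<^bold>\<and> \<chi>)"
  using mp[OF adj[OF assms] conj_imp] .

lemma imp_disjE:
  assumes "T \<turnstile>\<^sub>Q\<^sub>S\<^sub>L\<^sub>w \<phi> \<^bold>\<rightarrow> \<chi>" "T \<turnstile>\<^sub>Q\<^sub>S\<^sub>L\<^sub>w \<psi> \<^bold>\<rightarrow> \<chi>"
  shows "T \<turnstile>\<^sub>Q\<^sub>S\<^sub>L\<^sub>w (\<phi> \<^bold>\<or> \<psi>) \<^bold>\<rightarrow> \<chi>"
  using mp[OF adj[OF assms] disj_imp] .

lemma imp_disjI1: "T \<turnstile>\<^sub>Q\<^sub>S\<^sub>L\<^sub>w \<phi> \<^bold>\<rightarrow> \<psi> \<Longrightarrow> T \<turnstile>\<^sub>Q\<^sub>S\<^sub>L\<^sub>w \<phi> \<^bold>\<rightarrow> (\<psi> \<^bold>\<or> \<chi>)"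
  using imp_trans disjI1 by blast

lemma imp_disjI2: "T \<turnstile>\<^sub>Q\<^sub>S\<^sub>L\<^sub>w \<phi> \<^bold>\<rightarrow> \<chi> \<Longrightarrow> T \<turnstile>\<^sub>Q\<^sub>S\<^sub>L\<^sub>w \<phi> \<^bold>\<rightarrow> (\<psi> \<^bold>\<or> \<chi>)"
  using imp_trans disjI2 by blast

lemma conjD1: "T \<turnstile>\<^sub>Q\<^sub>S\<^sub>L\<^sub>w \<phi> \<^bold>\<and> \<psi> \<Longrightarrow> T \<turnstile>\<^sub>Q\<^sub>S\<^sub>L\<^sub>w \<phi>"
  using mp conjE1 by blast

lemma conjD2: "T \<turnstile>\<^sub>Q\<^sub>S\<^sub>L\<^sub>w \<phi> \<^bold>\<and> \<psi> \<Longrightarrow> T \<turnstile>\<^sub>Q\<^sub>S\<^sub>L\<^sub>w \<psi>"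
  using mp conjE2 by blast

lemma disj_cases:
  assumes "T \<turnstile>\<^sub>Q\<^sub>S\<^sub>L\<^sub>w \<phi> \<^bold>\<or> \<psi>" "T \<turnstile>\<^sub>Q\<^sub>S\<^sub>L\<^sub>w \<phi> \<^bold>\<rightarrow> \<chi>" "T \<turnstile>\<^sub>Q\<^sub>S\<^sub>L\<^sub>w \<psi> \<^bold>\<rightarrow> \<chi>"
  shows "T \<turnstile>\<^sub>Q\<^sub>S\<^sub>L\<^sub>w \<chi>"
  using mp[OF assms(1) imp_disjE[OF assms(2,3)]] .

lemma imp_suffixing: "T \<turnstile>\<^sub>Q\<^sub>S\<^sub>L\<^sub>w \<phi> \<^bold>\<rightarrow> \<psi> \<Longrightarrow> T \<turnstile>\<^sub>Q\<^sub>S\<^sub>L\<^sub>w (\<psi> \<^bold>\<rightarrow> \<chi>) \<^bold>\<rightarrow> (\<phi> \<^bold>\<rightarrow> \<chi>)"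
  using affix ident by blast

lemma imp_prefixing: "T \<turnstile>\<^sub>Q\<^sub>S\<^sub>L\<^sub>w \<psi> \<^bold>\<rightarrow> \<chi> \<Longrightarrow> T \<turnstile>\<^sub>Q\<^sub>S\<^sub>L\<^sub>w (\<phi> \<^bold>\<rightarrow> \<psi>) \<^bold>\<rightarrow> (\<phi> \<^bold>\<rightarrow> \<chi>)"
  using affix ident by blast

lemma imp_imp_mp:
  assumes "T \<turnstile>\<^sub>Q\<^sub>S\<^sub>L\<^sub>w \<phi> \<^bold>\<rightarrow> (\<psi> \<^bold>\<rightarrow> \<chi>)" "T \<turnstile>\<^sub>Q\<^sub>S\<^sub>L\<^sub>w \<psi>"
  shows "T \<turnstile>\<^sub>Q\<^sub>S\<^sub>L\<^sub>w \<phi> \<^bold>\<rightarrow> \<chi>"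
  using imp_trans[OF assms(1) assertion[OF assms(2)]] .

lemma imp_imp_conj: "T \<turnstile>\<^sub>Q\<^sub>S\<^sub>L\<^sub>w \<phi> \<^bold>\<rightarrow> (\<psi> \<^bold>\<rightarrow> (\<phi> \<^bold>\<and> \<psi>))"
  by (rule imp_trans[OF imp_conjI[OF weak imp_weaken[OF ident]] conj_imp])

text \<open>Importation fails without contraction; decidability of \<open>\<epsilon>\<close> makes up for it.\<close>

lemma decidable_importation:
  assumes decidable: "T \<turnstile>\<^sub>Q\<^sub>S\<^sub>L\<^sub>w \<epsilon> \<^bold>\<or> \<^bold>\<not> \<epsilon>"
    and antecedent: "T \<turnstile>\<^sub>Q\<^sub>S\<^sub>L\<^sub>w \<phi> \<^bold>\<rightarrow> \<epsilon>"
    and curried: "T \<turnstile>\<^sub>Q\<^sub>S\<^sub>L\<^sub>w \<epsilon> \<^bold>\<rightarrow> (\<psi> \<^bold>\<rightarrow> \<chi>)"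
  shows "T \<turnstile>\<^sub>Q\<^sub>S\<^sub>L\<^sub>w (\<phi> \<^bold>\<and> \<psi>) \<^bold>\<rightarrow> \<chi>"
  using decidable
proof (rule disj_cases)
  show "T \<turnstile>\<^sub>Q\<^sub>S\<^sub>L\<^sub>w \<epsilon> \<^bold>\<rightarrow> ((\<phi> \<^bold>\<and> \<psi>) \<^bold>\<rightarrow> \<chi>)"
    by (rule imp_trans[OF curried imp_suffixing[OF conjE2]])
  show "T \<turnstile>\<^sub>Q\<^sub>S\<^sub>L\<^sub>w \<^bold>\<not> \<epsilon> \<^bold>\<rightarrow> ((\<phi> \<^bold>\<and> \<psi>) \<^bold>\<rightarrow> \<chi>)"
    by (rule affix[OF imp_trans[OF conjE1 antecedent] bot])
qed

lemma decidable_disj: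
  assumes "T \<turnstile>\<^sub>Q\<^sub>S\<^sub>L\<^sub>w \<phi> \<^bold>\<or> \<^bold>\<not> \<phi>" "T \<turnstile>\<^sub>Q\<^sub>S\<^sub>L\<^sub>w \<psi> \<^bold>\<or> \<^bold>\<not> \<psi>"
  shows "T \<turnstile>\<^sub>Q\<^sub>S\<^sub>L\<^sub>w (\<phi> \<^bold>\<or> \<psi>) \<^bold>\<or> \<^bold>\<not> (\<phi> \<^bold>\<or> \<psi>)" (is "_ \<turnstile>\<^sub>Q\<^sub>S\<^sub>L\<^sub>w ?decided")
  using assms(1)
proof (rule disj_cases)
  show "T \<turnstile>\<^sub>Q\<^sub>S\<^sub>L\<^sub>w \<phi> \<^bold>\<rightarrow> ?decided" by (rule imp_disjI1[OF disjI1])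
  have "T \<turnstile>\<^sub>Q\<^sub>S\<^sub>L\<^sub>w \<^bold>\<not> \<phi> \<^bold>\<rightarrow> (\<psi> \<^bold>\<rightarrow> ?decided)"
    by (rule imp_weaken[OF imp_disjI1[OF disjI2]])
  moreover have "T \<turnstile>\<^sub>Q\<^sub>S\<^sub>L\<^sub>w \<^bold>\<not> \<phi> \<^bold>\<rightarrow> (\<^bold>\<not> \<psi> \<^bold>\<rightarrow> ?decided)"
    by (rule imp_trans[OF imp_imp_conj imp_prefixing[OF imp_disjI2[OF disj_imp]]])
  ultimately have "T \<turnstile>\<^sub>Q\<^sub>S\<^sub>L\<^sub>w \<^bold>\<not> \<phi> \<^bold>\<rightarrow> ((\<psi> \<^bold>\<or> \<^bold>\<not> \<psi>) \<^bold>\<rightarrow> ?decided)"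
    by (rule imp_trans[OF imp_conjI disj_imp])
  then show "T \<turnstile>\<^sub>Q\<^sub>S\<^sub>L\<^sub>w \<^bold>\<not> \<phi> \<^bold>\<rightarrow> ?decided" by (rule imp_imp_mp[OF _ assms(2)])
qed

lemma decidable_iff:
  assumes iff: "T \<turnstile>\<^sub>Q\<^sub>S\<^sub>L\<^sub>w \<phi> \<^bold>\<leftrightarrow> \<psi>" and decidable: "T \<turnstile>\<^sub>Q\<^sub>S\<^sub>L\<^sub>w \<psi> \<^bold>\<or> \<^bold>\<not> \<psi>"
  shows "T \<turnstile>\<^sub>Q\<^sub>S\<^sub>L\<^sub>w \<phi> \<^bold>\<or> \<^bold>\<not> \<phi>"
  using decidable
proof (rule disj_cases)
  show "T \<turnstile>\<^sub>Q\<^sub>S\<^sub>L\<^sub>w \<psi> \<^bold>\<rightarrow> (\<phi> \<^bold>\<or> \<^bold>\<not> \<phi>)" by (rule imp_disjI1[OF conjD2[OF iff]])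
  show "T \<turnstile>\<^sub>Q\<^sub>S\<^sub>L\<^sub>w \<^bold>\<not> \<psi> \<^bold>\<rightarrow> (\<phi> \<^bold>\<or> \<^bold>\<not> \<phi>)" by (rule imp_disjI2[OF imp_suffixing[OF conjD1[OF iff]]])
qed

section \<open>Substitution\<close>

primrec bv :: "fm \<Rightarrow> var set" where
  "bv \<^bold>\<bottom> = {}"
| "bv (t \<^bold>= s) = {}"
| "bv (t \<^bold>\<le> s) = {}"
| "bv (A r s t) = {}"
| "bv (M r s t) = {}"
| "bv (\<phi> \<^bold>\<rightarrow> \<psi>) = bv \<phi> \<union> bv \<psi>"
| "bv (\<phi> \<^bold>\<and> \<psi>) = bv \<phi> \<union> bv \<psi>"
| "bv (\<phi> \<^bold>\<or> \<psi>) = bv \<phi> \<union> bv \<psi>"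
| "bv (All y \<phi>) = insert y (bv \<phi>)"
| "bv (Ex y \<phi>) = insert y (bv \<phi>)"

lemma finite_tvars [simp]: "finite (tvars t)"
  by (induction t) auto

lemma finite_fv [simp]: "finite (fv \<phi>)"
  by (induction \<phi>) auto

lemma finite_bv [simp]: "finite (bv \<phi>)"
  by (induction \<phi>) auto

lemma tsubst_fresh [simp]: "x \<notin> tvars s \<Longrightarrow> tsubst x t s = s"
  by (induction s) auto

lemma subst_fresh [simp]: "x \<notin> fv \<phi> \<Longrightarrow> subst x t \<phi> = \<phi>"
  by (induction \<phi>) auto

lemma tsubst_Var_self [simp]: "tsubst x (Var x) t = t"
  by (induction t) auto

lemma subst_Var_self [simp]: "subst x (Var x) \<phi> = \<phi>"
  by (induction \<phi>) auto

lemma tsubst_tsubst_Var: "y \<notin> tvars s \<Longrightarrow> tsubst y t (tsubst x (Var y) s) = tsubst x t s"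
  by (induction s) auto

lemma subst_subst_Var:
  "y \<notin> fv \<phi> \<union> bv \<phi> \<Longrightarrow> subst y t (subst x (Var y) \<phi>) = subst x t \<phi>"
  by (induction \<phi>) (auto simp: tsubst_tsubst_Var)

lemma substitutable_fresh [simp]: "x \<notin> fv \<phi> \<Longrightarrow> substitutable t x \<phi>"
  by (induction \<phi>) auto

lemma substitutable_Var_self [simp]: "substitutable (Var x) x \<phi>"
  by (induction \<phi>) auto

lemma substitutable_if_bv_disjoint: "bv \<phi> \<inter> tvars t = {} \<Longrightarrow> substitutable t x \<phi>"
  by (induction \<phi>) auto

lemma substitutable_subst_Var:
  "y \<notin> fv \<phi> \<union> bv \<phi> \<Longrightarrow> substitutable t x \<phi> \<Longrightarrow> substitutable t y (subst x (Var y) \<phi>)"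
  by (induction \<phi>) auto

lemma derivable_subst:
  assumes "T \<turnstile>\<^sub>Q\<^sub>S\<^sub>L\<^sub>w \<phi>" "substitutable t x \<phi>"
  shows "T \<turnstile>\<^sub>Q\<^sub>S\<^sub>L\<^sub>w subst x t \<phi>"
proof -
  have "T \<turnstile>\<^sub>Q\<^sub>S\<^sub>L\<^sub>w (\<^bold>\<bottom> \<^bold>\<rightarrow> \<^bold>\<bottom>) \<^bold>\<rightarrow> All x \<phi>"
    by (rule all_gen[OF imp_weaken[OF assms(1)]]) simp
  from mp[OF mp[OF ident this] all_inst[OF assms(2)]] show ?thesis .
qed

subsection \<open>Simultaneous substitution\<close>

primrec tinst :: "(var \<Rightarrow> tm) \<Rightarrow> tm \<Rightarrow> tm" where
  "tinst \<sigma> (Var x) = \<sigma> x"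
| "tinst \<sigma> Zero = Zero"
| "tinst \<sigma> (S t) = S (tinst \<sigma> t)"

primrec inst :: "(var \<Rightarrow> tm) \<Rightarrow> fm \<Rightarrow> fm" where
  "inst \<sigma> \<^bold>\<bottom> = \<^bold>\<bottom>"
| "inst \<sigma> (t \<^bold>= s) = (tinst \<sigma> t \<^bold>= tinst \<sigma> s)"
| "inst \<sigma> (t \<^bold>\<le> s) = (tinst \<sigma> t \<^bold>\<le> tinst \<sigma> s)"
| "inst \<sigma> (A r s t) = A (tinst \<sigma> r) (tinst \<sigma> s) (tinst \<sigma> t)"
| "inst \<sigma> (M r s t) = M (tinst \<sigma> r) (tinst \<sigma> s) (tinst \<sigma> t)"
| "inst \<sigma> (\<phi> \<^bold>\<rightarrow> \<psi>) = (inst \<sigma> \<phi> \<^bold>\<rightarrow> inst \<sigma> \<psi>)"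
| "inst \<sigma> (\<phi> \<^bold>\<and> \<psi>) = (inst \<sigma> \<phi> \<^bold>\<and> inst \<sigma> \<psi>)"
| "inst \<sigma> (\<phi> \<^bold>\<or> \<psi>) = (inst \<sigma> \<phi> \<^bold>\<or> inst \<sigma> \<psi>)"
| "inst \<sigma> (All y \<phi>) = All y (inst (\<sigma>(y := Var y)) \<phi>)"
| "inst \<sigma> (Ex y \<phi>) = Ex y (inst (\<sigma>(y := Var y)) \<phi>)"

lemma bv_inst [simp]: "bv (inst \<sigma> \<phi>) = bv \<phi>"
  by (induction \<phi> arbitrary: \<sigma>) auto

lemma tinst_Var [simp]: "tinst Var t = t"
  by (induction t) auto

lemma inst_Var [simp]: "inst Var \<phi> = \<phi>"
  by (induction \<phi>) auto

lemma tinst_cong: "(\<And>x. x \<in> tvars t \<Longrightarrow> \<sigma> x = \<tau> x) \<Longrightarrow> tinst \<sigma> t = tinst \<tau> t"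
  by (induction t) auto

lemma inst_cong: "(\<And>x. x \<in> fv \<phi> \<Longrightarrow> \<sigma> x = \<tau> x) \<Longrightarrow> inst \<sigma> \<phi> = inst \<tau> \<phi>"
proof (induction \<phi> arbitrary: \<sigma> \<tau>)
  case (All y \<phi>)
  have "inst (\<sigma>(y := Var y)) \<phi> = inst (\<tau>(y := Var y)) \<phi>"
    by (rule All.IH) (use All.prems in simp)
  then show ?case by simp
next
  case (Ex y \<phi>)
  have "inst (\<sigma>(y := Var y)) \<phi> = inst (\<tau>(y := Var y)) \<phi>"
    by (rule Ex.IH) (use Ex.prems in simp)
  then show ?case by simp
qed (simp_all (no_asm), (metis UnCI fv.simps(2-8) tinst_cong)+)

lemma tinst_tinst: "tinst \<tau> (tinst \<sigma> t) = tinst (\<lambda>x. tinst \<tau> (\<sigma> x)) t"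
  by (induction t) auto

lemma tinst_fun_upd_bound:
  "\<tau> y = Var y \<Longrightarrow> (\<lambda>x. tinst \<tau> ((\<sigma>(y := Var y)) x)) = (\<lambda>x. tinst \<tau> (\<sigma> x))(y := Var y)"
  by auto

lemma inst_inst:
  "(\<And>y. y \<in> bv \<phi> \<Longrightarrow> \<tau> y = Var y) \<Longrightarrow> inst \<tau> (inst \<sigma> \<phi>) = inst (\<lambda>x. tinst \<tau> (\<sigma> x)) \<phi>"
proof (induction \<phi> arbitrary: \<sigma>)
  case (All y \<phi>)
  then show ?case by (simp add: fun_upd_idem tinst_fun_upd_bound del: fun_upd_apply)
next
  case (Ex y \<phi>)
  then show ?case by (simp add: fun_upd_idem tinst_fun_upd_bound del: fun_upd_apply)
qed (auto simp: tinst_tinst)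

lemma tsubst_tinst:
  "\<sigma> x = Var x \<Longrightarrow> (\<And>y. y \<noteq> x \<Longrightarrow> x \<notin> tvars (\<sigma> y)) \<Longrightarrow> tsubst x t (tinst \<sigma> s) = tinst (\<sigma>(x := t)) s"
  by (induction s) auto

lemma subst_inst:
  "\<sigma> x = Var x \<Longrightarrow> (\<And>y. y \<noteq> x \<Longrightarrow> x \<notin> tvars (\<sigma> y)) \<Longrightarrow> subst x t (inst \<sigma> \<phi>) = inst (\<sigma>(x := t)) \<phi>"
proof (induction \<phi> arbitrary: \<sigma>)
  case (All y \<phi>)
  have "subst x t (inst (\<sigma>(y := Var y)) \<phi>) = inst (\<sigma>(y := Var y, x := t)) \<phi>" if "y \<noteq> x"
    by (rule All.IH) (use All.prems that in auto)
  then show "subst x t (inst \<sigma> (All y \<phi>)) = inst (\<sigma>(x := t)) (All y \<phi>)"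
    using All.prems by (auto simp: fun_upd_twist[of x y])
next
  case (Ex y \<phi>)
  have "subst x t (inst (\<sigma>(y := Var y)) \<phi>) = inst (\<sigma>(y := Var y, x := t)) \<phi>" if "y \<noteq> x"
    by (rule Ex.IH) (use Ex.prems that in auto)
  then show "subst x t (inst \<sigma> (Ex y \<phi>)) = inst (\<sigma>(x := t)) (Ex y \<phi>)"
    using Ex.prems by (auto simp: fun_upd_twist[of x y])
qed (auto simp: tsubst_tinst)

lemma derivable_inst_disjoint:
  assumes "finite V" and derivable: "T \<turnstile>\<^sub>Q\<^sub>S\<^sub>L\<^sub>w \<phi>"
    and support: "\<And>x. x \<notin> V \<Longrightarrow> \<sigma> x = Var x"
    and disjoint: "\<And>x. x \<in> V \<Longrightarrow> tvars (\<sigma> x) \<inter> (V \<union> bv \<phi>) = {}"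
  shows "T \<turnstile>\<^sub>Q\<^sub>S\<^sub>L\<^sub>w inst \<sigma> \<phi>"
  using \<open>finite V\<close> support disjoint
proof (induction V arbitrary: \<sigma> rule: finite_induct)
  case empty
  then have "\<sigma> = Var" by auto
  then show ?case using derivable by simp
next
  case (insert x V)
  let ?\<tau> = "\<sigma>(x := Var x)"
  have "T \<turnstile>\<^sub>Q\<^sub>S\<^sub>L\<^sub>w inst ?\<tau> \<phi>" by (rule insert.IH) (use insert in auto)
  moreover have "substitutable (\<sigma> x) x (inst ?\<tau> \<phi>)"
    using insert.prems(2)[of x] by (intro substitutable_if_bv_disjoint) auto
  ultimately have "T \<turnstile>\<^sub>Q\<^sub>S\<^sub>L\<^sub>w subst x (\<sigma> x) (inst ?\<tau> \<phi>)" by (rule derivable_subst)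
  moreover have "x \<notin> tvars (\<sigma> y)" if "y \<noteq> x" for y
    using that insert.prems by (cases "y \<in> V") auto
  ultimately show ?case by (simp add: subst_inst)
qed

text \<open>The free variables are first shifted out of the way, so that the terms replacing them cannot
  interfere.\<close>

lemma derivable_inst:
  assumes "T \<turnstile>\<^sub>Q\<^sub>S\<^sub>L\<^sub>w \<phi>" and capture_free: "\<forall>x \<in> fv \<phi>. tvars (\<sigma> x) \<inter> bv \<phi> = {}"
  shows "T \<turnstile>\<^sub>Q\<^sub>S\<^sub>L\<^sub>w inst \<sigma> \<phi>"
proof -
  let ?vars = "fv \<phi> \<union> bv \<phi> \<union> (\<Union>x \<in> fv \<phi>. tvars (\<sigma> x))"
  obtain N where "\<forall>x \<in> ?vars. x < N"
    using finite_nat_set_iff_bounded[of ?vars] by auto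
  then have fresh: "x + N \<notin> ?vars" for x by (meson not_add_less2)
  define shift where "shift x = (if x \<in> fv \<phi> then Var (x + N) else Var x)" for x
  define unshift where "unshift x = (if x \<in> (\<lambda>x. x + N) ` fv \<phi> then \<sigma> (x - N) else Var x)" for x
  have "T \<turnstile>\<^sub>Q\<^sub>S\<^sub>L\<^sub>w inst shift \<phi>"
  proof (rule derivable_inst_disjoint)
    show "tvars (shift x) \<inter> (fv \<phi> \<union> bv \<phi>) = {}" if "x \<in> fv \<phi>" for x
      using fresh[of x] that by (simp add: shift_def)
  qed (use assms(1) in \<open>simp_all add: shift_def\<close>)
  then have "T \<turnstile>\<^sub>Q\<^sub>S\<^sub>L\<^sub>w inst unshift (inst shift \<phi>)"
  proof (rule derivable_inst_disjoint[rotated])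
    fix x assume "x \<in> (\<lambda>x. x + N) ` fv \<phi>"
    then obtain y where "y \<in> fv \<phi>" "unshift x = \<sigma> y" by (auto simp: unshift_def)
    then show "tvars (unshift x) \<inter> ((\<lambda>x. x + N) ` fv \<phi> \<union> bv (inst shift \<phi>)) = {}"
      using fresh capture_free by auto
  qed (simp_all add: unshift_def)
  also have "inst unshift (inst shift \<phi>) = inst (\<lambda>x. tinst unshift (shift x)) \<phi>"
    using fresh by (intro inst_inst) (auto simp: unshift_def)
  also have "inst (\<lambda>x. tinst unshift (shift x)) \<phi> = inst \<sigma> \<phi>"
    by (rule inst_cong) (simp add: shift_def unshift_def)
  finally show ?thesis .
qed

section \<open>Equality\<close>

lemma eq_refl_tm: "T \<turnstile>\<^sub>Q\<^sub>S\<^sub>L\<^sub>w t \<^bold>= t"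
  using derivable_subst[OF eq_refl[of T 0], of t 0] by simp

lemma ex_fresh:
  assumes "finite B"
  obtains x :: var where "x \<notin> B"
  using ex_new_if_finite[OF infinite_UNIV_nat assms] by blast

lemma eq_replacement:
  assumes "substitutable s x \<phi>"
  shows "T \<turnstile>\<^sub>Q\<^sub>S\<^sub>L\<^sub>w s \<^bold>= Var x \<^bold>\<rightarrow> (subst x s \<phi> \<^bold>\<rightarrow> \<phi>)"
proof -
  obtain w where w: "w \<notin> insert x (fv \<phi> \<union> bv \<phi>)"
    by (rule ex_fresh[of "insert x (fv \<phi> \<union> bv \<phi>)"]) auto
  let ?\<psi> = "subst x (Var w) \<phi>"
  have "T \<turnstile>\<^sub>Q\<^sub>S\<^sub>L\<^sub>w Var w \<^bold>= Var x \<^bold>\<rightarrow> (?\<psi> \<^bold>\<rightarrow> subst w (Var x) ?\<psi>)"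
    using w by (intro eq_fm substitutable_subst_Var) auto
  then have "T \<turnstile>\<^sub>Q\<^sub>S\<^sub>L\<^sub>w Var w \<^bold>= Var x \<^bold>\<rightarrow> (?\<psi> \<^bold>\<rightarrow> \<phi>)"
    using w by (simp add: subst_subst_Var)
  then have "T \<turnstile>\<^sub>Q\<^sub>S\<^sub>L\<^sub>w subst w s (Var w \<^bold>= Var x \<^bold>\<rightarrow> (?\<psi> \<^bold>\<rightarrow> \<phi>))"
    using w assms by (intro derivable_subst) (auto simp: substitutable_subst_Var)
  then show ?thesis using w by (simp add: subst_subst_Var)
qed

lemma eq_imp_if_subst:
  assumes "T \<turnstile>\<^sub>Q\<^sub>S\<^sub>L\<^sub>w subst x s \<phi>" "substitutable s x \<phi>"
  shows "T \<turnstile>\<^sub>Q\<^sub>S\<^sub>L\<^sub>w s \<^bold>= Var x \<^bold>\<rightarrow> \<phi>"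
  using imp_imp_mp[OF eq_replacement[OF assms(2)] assms(1)] .

lemma eq_sym_tm: "T \<turnstile>\<^sub>Q\<^sub>S\<^sub>L\<^sub>w s \<^bold>= t \<^bold>\<rightarrow> t \<^bold>= s"
proof -
  obtain x where x: "x \<notin> tvars s" by (rule ex_fresh[of "tvars s"]) auto
  then have "T \<turnstile>\<^sub>Q\<^sub>S\<^sub>L\<^sub>w s \<^bold>= Var x \<^bold>\<rightarrow> Var x \<^bold>= s"
    by (intro eq_imp_if_subst) (simp_all add: eq_refl_tm)
  from derivable_subst[OF this, of t x] x show ?thesis by simp
qed

lemma eq_S_cong: "T \<turnstile>\<^sub>Q\<^sub>S\<^sub>L\<^sub>w s \<^bold>= t \<^bold>\<rightarrow> S s \<^bold>= S t"
proof -
  obtain x where x: "x \<notin> tvars s" by (rule ex_fresh[of "tvars s"]) auto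
  then have "T \<turnstile>\<^sub>Q\<^sub>S\<^sub>L\<^sub>w s \<^bold>= Var x \<^bold>\<rightarrow> S s \<^bold>= S (Var x)"
    by (intro eq_imp_if_subst) (simp_all add: eq_refl_tm)
  from derivable_subst[OF this, of t x] x show ?thesis by simp
qed

section \<open>Numerals and bounded disjunctions\<close>

lemma tvars_num [simp]: "tvars (num n) = {}"
  by (induction n) auto

lemma tinst_num [simp]: "tinst \<sigma> (num n) = num n"
  by (induction n) auto

lemma fv_eq_some_upto [simp]: "fv (eq_some_upto t n) = tvars t"
  by (induction n) auto

lemma subst_eq_some_upto [simp]:
  "subst x s (eq_some_upto t n) = eq_some_upto (tsubst x s t) n"
  by (induction n) auto

lemma substitutable_eq_some_upto [simp]: "substitutable s x (eq_some_upto t n)"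
  by (induction n) auto

lemma eq_some_uptoI: "i \<le> n \<Longrightarrow> T \<turnstile>\<^sub>Q\<^sub>S\<^sub>L\<^sub>w t \<^bold>= num i \<^bold>\<rightarrow> eq_some_upto t n"
proof (induction n)
  case 0
  then show ?case using ident by simp
next
  case (Suc n)
  then show ?case using imp_disjI1 disjI2 by (cases "i = Suc n") auto
qed

lemma eq_some_uptoE:
  "(\<And>i. i \<le> n \<Longrightarrow> T \<turnstile>\<^sub>Q\<^sub>S\<^sub>L\<^sub>w t \<^bold>= num i \<^bold>\<rightarrow> \<chi>) \<Longrightarrow> T \<turnstile>\<^sub>Q\<^sub>S\<^sub>L\<^sub>w eq_some_upto t n \<^bold>\<rightarrow> \<chi>"
proof (induction n)
  case 0
  from 0[of 0] show ?case by simp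
next
  case (Suc n)
  have "T \<turnstile>\<^sub>Q\<^sub>S\<^sub>L\<^sub>w eq_some_upto t n \<^bold>\<rightarrow> \<chi>" by (rule Suc.IH) (use Suc.prems in simp)
  from imp_disjE[OF this Suc.prems[of "Suc n"]] show ?case by simp
qed

lemma eq_some_upto_S: "T \<turnstile>\<^sub>Q\<^sub>S\<^sub>L\<^sub>w eq_some_upto t n \<^bold>\<rightarrow> eq_some_upto (S t) (Suc n)"
proof (rule eq_some_uptoE)
  fix i assume "i \<le> n"
  have "T \<turnstile>\<^sub>Q\<^sub>S\<^sub>L\<^sub>w t \<^bold>= num i \<^bold>\<rightarrow> S t \<^bold>= num (Suc i)" using eq_S_cong by simp
  also have "T \<turnstile>\<^sub>Q\<^sub>S\<^sub>L\<^sub>w S t \<^bold>= num (Suc i) \<^bold>\<rightarrow> eq_some_upto (S t) (Suc n)"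
    by (rule eq_some_uptoI) (use \<open>i \<le> n\<close> in simp)
  finally show "T \<turnstile>\<^sub>Q\<^sub>S\<^sub>L\<^sub>w t \<^bold>= num i \<^bold>\<rightarrow> eq_some_upto (S t) (Suc n)" .
qed

section \<open>Arithmetic in extensions of the base theory\<close>

locale Q_sim_extension =
  fixes T :: "fm set"
  assumes Q_sim_base_subset: "Q_sim_base \<subseteq> T"
begin

subsection \<open>Instances of the axioms\<close>

lemma derivable_axiom_inst:
  assumes "\<phi> \<in> Q_sim_base" "\<forall>x \<in> fv \<phi>. tvars (\<sigma> x) \<inter> bv \<phi> = {}"
  shows "T \<turnstile>\<^sub>Q\<^sub>S\<^sub>L\<^sub>w inst \<sigma> \<phi>"
  using assms Q_sim_base_subset by (intro derivable_inst hyp) auto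

lemma eq_decidable: "T \<turnstile>\<^sub>Q\<^sub>S\<^sub>L\<^sub>w s \<^bold>= t \<^bold>\<or> s \<^bold>\<noteq> t"
  using derivable_axiom_inst[of "X \<^bold>= Y \<^bold>\<or> X \<^bold>\<noteq> Y" "Var(vx := s, vy := t)"]
  by (simp add: Q_sim_base_def)

lemma S_neq_Zero: "T \<turnstile>\<^sub>Q\<^sub>S\<^sub>L\<^sub>w S t \<^bold>\<noteq> Zero"
  using derivable_axiom_inst[of "S X \<^bold>\<noteq> Zero" "Var(vx := t)"]
  by (simp add: Q_sim_base_def)

lemma S_inject: "T \<turnstile>\<^sub>Q\<^sub>S\<^sub>L\<^sub>w S s \<^bold>= S t \<^bold>\<rightarrow> s \<^bold>= t"
  using derivable_axiom_inst[of "S X \<^bold>= S Y \<^bold>\<rightarrow> X \<^bold>= Y" "Var(vx := s, vy := t)"]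
  by (simp add: Q_sim_base_def)

lemma neq_Zero_imp_ex_S: "vy \<notin> tvars t \<Longrightarrow> T \<turnstile>\<^sub>Q\<^sub>S\<^sub>L\<^sub>w t \<^bold>\<noteq> Zero \<^bold>\<rightarrow> Ex vy (t \<^bold>= S Y)"
  using derivable_axiom_inst[of "X \<^bold>\<noteq> Zero \<^bold>\<rightarrow> Ex vy (X \<^bold>= S Y)" "Var(vx := t)"]
  by (simp add: Q_sim_base_def)

lemma A_Zero_iff: "T \<turnstile>\<^sub>Q\<^sub>S\<^sub>L\<^sub>w A s Zero t \<^bold>\<leftrightarrow> s \<^bold>= t"
  using derivable_axiom_inst[of "A X Zero Y \<^bold>\<leftrightarrow> X \<^bold>= Y" "Var(vx := s, vy := t)"]
  by (simp add: Q_sim_base_def)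

lemma A_S_iff:
  assumes "vu \<notin> tvars r \<union> tvars s \<union> tvars t"
  shows "T \<turnstile>\<^sub>Q\<^sub>S\<^sub>L\<^sub>w A r (S s) t \<^bold>\<leftrightarrow> Ex vu (A r s U \<^bold>\<and> t \<^bold>= S U)"
  using assms derivable_axiom_inst[of "A X (S Y) Z \<^bold>\<leftrightarrow> Ex vu (A X Y U \<^bold>\<and> Z \<^bold>= S U)"
      "Var(vx := r, vy := s, vz := t)"]
  by (auto simp: Q_sim_base_def)

lemma M_Zero_iff: "T \<turnstile>\<^sub>Q\<^sub>S\<^sub>L\<^sub>w M s Zero t \<^bold>\<leftrightarrow> t \<^bold>= Zero"
  using derivable_axiom_inst[of "M X Zero Y \<^bold>\<leftrightarrow> Y \<^bold>= Zero" "Var(vx := s, vy := t)"]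
  by (simp add: Q_sim_base_def)

lemma M_S_imp_ex:
  assumes "vu \<notin> tvars r \<union> tvars s \<union> tvars t"
  shows "T \<turnstile>\<^sub>Q\<^sub>S\<^sub>L\<^sub>w M r (S s) t \<^bold>\<rightarrow> Ex vu (M r s U \<^bold>\<and> A U r t)"
  using assms derivable_axiom_inst[of "M X (S Y) Z \<^bold>\<rightarrow> Ex vu (M X Y U \<^bold>\<and> A U X Z)"
      "Var(vx := r, vy := s, vz := t)"]
  by (auto simp: Q_sim_base_def)

lemma Le_iff:
  assumes "vz \<notin> tvars s \<union> tvars t"
  shows "T \<turnstile>\<^sub>Q\<^sub>S\<^sub>L\<^sub>w s \<^bold>\<le> t \<^bold>\<leftrightarrow> Ex vz (A Z s t)"
  using assms derivable_axiom_inst[of "X \<^bold>\<le> Y \<^bold>\<leftrightarrow> Ex vz (A Z X Y)" "Var(vx := s, vy := t)"]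
  by (auto simp: Q_sim_base_def)

lemma A_S_intro:
  assumes "vu \<notin> tvars r \<union> tvars s \<union> tvars t"
  shows "T \<turnstile>\<^sub>Q\<^sub>S\<^sub>L\<^sub>w (A r s p \<^bold>\<and> t \<^bold>= S p) \<^bold>\<rightarrow> A r (S s) t"
  using imp_trans[OF ex_inst[of p vu "A r s U \<^bold>\<and> t \<^bold>= S U" T] conjD2[OF A_S_iff]] assms by simp

lemma A_S_elim:
  assumes "T \<turnstile>\<^sub>Q\<^sub>S\<^sub>L\<^sub>w (A r s U \<^bold>\<and> t \<^bold>= S U) \<^bold>\<rightarrow> \<chi>"
    and "vu \<notin> tvars r \<union> tvars s \<union> tvars t \<union> fv \<chi>"
  shows "T \<turnstile>\<^sub>Q\<^sub>S\<^sub>L\<^sub>w A r (S s) t \<^bold>\<rightarrow> \<chi>"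
  using imp_trans[OF conjD1[OF A_S_iff] ex_gen[OF assms(1)]] assms(2) by simp

lemma M_S_elim:
  assumes "T \<turnstile>\<^sub>Q\<^sub>S\<^sub>L\<^sub>w (M r s U \<^bold>\<and> A U r t) \<^bold>\<rightarrow> \<chi>"
    and "vu \<notin> tvars r \<union> tvars s \<union> tvars t \<union> fv \<chi>"
  shows "T \<turnstile>\<^sub>Q\<^sub>S\<^sub>L\<^sub>w M r (S s) t \<^bold>\<rightarrow> \<chi>"
  using imp_trans[OF M_S_imp_ex ex_gen[OF assms(1)]] assms(2) by simp

lemma A_imp_Le:
  assumes "vz \<notin> tvars s \<union> tvars t"
  shows "T \<turnstile>\<^sub>Q\<^sub>S\<^sub>L\<^sub>w A r s t \<^bold>\<rightarrow> s \<^bold>\<le> t"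
  using imp_trans[OF ex_inst[of r vz "A Z s t" T] conjD2[OF Le_iff]] assms by simp

lemma Le_elim:
  assumes "T \<turnstile>\<^sub>Q\<^sub>S\<^sub>L\<^sub>w A Z s t \<^bold>\<rightarrow> \<chi>" "vz \<notin> tvars s \<union> tvars t \<union> fv \<chi>"
  shows "T \<turnstile>\<^sub>Q\<^sub>S\<^sub>L\<^sub>w s \<^bold>\<le> t \<^bold>\<rightarrow> \<chi>"
  using imp_trans[OF conjD1[OF Le_iff] ex_gen[OF assms(1)]] assms(2) by simp

lemma conj_imp_if_eq:
  assumes "T \<turnstile>\<^sub>Q\<^sub>S\<^sub>L\<^sub>w \<phi> \<^bold>\<rightarrow> s \<^bold>= Var x"
    and "T \<turnstile>\<^sub>Q\<^sub>S\<^sub>L\<^sub>w subst x s (\<psi> \<^bold>\<rightarrow> \<chi>)" "substitutable s x (\<psi> \<^bold>\<rightarrow> \<chi>)"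
  shows "T \<turnstile>\<^sub>Q\<^sub>S\<^sub>L\<^sub>w (\<phi> \<^bold>\<and> \<psi>) \<^bold>\<rightarrow> \<chi>"
  using decidable_importation[OF eq_decidable assms(1) eq_imp_if_subst[OF assms(2,3)]] .

lemma Zero_S_cases:
  assumes zero: "T \<turnstile>\<^sub>Q\<^sub>S\<^sub>L\<^sub>w subst x Zero \<phi>" "substitutable Zero x \<phi>"
    and succ: "T \<turnstile>\<^sub>Q\<^sub>S\<^sub>L\<^sub>w subst x (S Y) \<phi>" "substitutable (S Y) x \<phi>"
    and fresh: "vy \<notin> insert x (fv \<phi>)"
  shows "T \<turnstile>\<^sub>Q\<^sub>S\<^sub>L\<^sub>w \<phi>"
proof (rule disj_cases[OF eq_decidable[of "Var x" Zero]])
  show "T \<turnstile>\<^sub>Q\<^sub>S\<^sub>L\<^sub>w Var x \<^bold>= Zero \<^bold>\<rightarrow> \<phi>"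
    by (rule imp_trans[OF eq_sym_tm eq_imp_if_subst[OF zero]])
  have "T \<turnstile>\<^sub>Q\<^sub>S\<^sub>L\<^sub>w Var x \<^bold>\<noteq> Zero \<^bold>\<rightarrow> Ex vy (Var x \<^bold>= S Y)"
    by (rule neq_Zero_imp_ex_S) (use fresh in simp)
  also have "T \<turnstile>\<^sub>Q\<^sub>S\<^sub>L\<^sub>w Ex vy (Var x \<^bold>= S Y) \<^bold>\<rightarrow> \<phi>"
    by (rule ex_gen[OF imp_trans[OF eq_sym_tm eq_imp_if_subst[OF succ]]]) (use fresh in simp)
  finally show "T \<turnstile>\<^sub>Q\<^sub>S\<^sub>L\<^sub>w Var x \<^bold>\<noteq> Zero \<^bold>\<rightarrow> \<phi>" .
qed

subsection \<open>Addition and multiplication of numerals\<close>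

lemma num_neq_num: "m \<noteq> n \<Longrightarrow> T \<turnstile>\<^sub>Q\<^sub>S\<^sub>L\<^sub>w num m \<^bold>\<noteq> num n"
proof (induction m n rule: diff_induct)
  case (1 m)
  then obtain k where "m = Suc k" by (cases m) auto
  then show ?case using S_neq_Zero by simp
next
  case (2 n)
  show ?case using imp_trans[OF eq_sym_tm S_neq_Zero] by simp
next
  case (3 m n)
  then show ?case using imp_trans[OF S_inject] by simp
qed

lemma A_num: "T \<turnstile>\<^sub>Q\<^sub>S\<^sub>L\<^sub>w A (num m) (num n) (num (m + n))"
proof (induction n)
  case 0
  show ?case using mp[OF eq_refl_tm conjD2[OF A_Zero_iff]] by simp
next
  case (Suc n)
  from mp[OF adj[OF Suc.IH eq_refl_tm] A_S_intro] show ?case by simp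
qed

lemma A_num_imp_eq: "T \<turnstile>\<^sub>Q\<^sub>S\<^sub>L\<^sub>w A (num m) (num n) t \<^bold>\<rightarrow> num (m + n) \<^bold>= t"
proof (induction n arbitrary: t)
  case 0
  show ?case using conjD1[OF A_Zero_iff] by simp
next
  case (Suc n)
  have "T \<turnstile>\<^sub>Q\<^sub>S\<^sub>L\<^sub>w (A (num m) (num n) U \<^bold>\<and> X \<^bold>= S U) \<^bold>\<rightarrow> S (num (m + n)) \<^bold>= X"
    by (rule conj_imp_if_eq[OF Suc.IH]) (simp_all add: eq_sym_tm)
  then have "T \<turnstile>\<^sub>Q\<^sub>S\<^sub>L\<^sub>w A (num m) (S (num n)) X \<^bold>\<rightarrow> S (num (m + n)) \<^bold>= X"
    by (rule A_S_elim) simp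
  from derivable_subst[OF this, of t vx] show ?case by simp
qed

lemma A_num_iff: "T \<turnstile>\<^sub>Q\<^sub>S\<^sub>L\<^sub>w A (num m) (num n) X \<^bold>\<leftrightarrow> num (m + n) \<^bold>= X"
proof (rule adj[OF A_num_imp_eq])
  show "T \<turnstile>\<^sub>Q\<^sub>S\<^sub>L\<^sub>w num (m + n) \<^bold>= X \<^bold>\<rightarrow> A (num m) (num n) X"
    by (rule eq_imp_if_subst) (simp_all add: A_num)
qed

lemma M_num_imp_eq: "T \<turnstile>\<^sub>Q\<^sub>S\<^sub>L\<^sub>w M (num m) (num n) t \<^bold>\<rightarrow> num (m * n) \<^bold>= t"
proof (induction n arbitrary: t)
  case 0
  show ?case using imp_trans[OF conjD1[OF M_Zero_iff] eq_sym_tm] by simp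
next
  case (Suc n)
  have "T \<turnstile>\<^sub>Q\<^sub>S\<^sub>L\<^sub>w (M (num m) (num n) U \<^bold>\<and> A U (num m) X) \<^bold>\<rightarrow> num (m * n + m) \<^bold>= X"
    by (rule conj_imp_if_eq[OF Suc.IH]) (simp_all add: A_num_imp_eq)
  then have "T \<turnstile>\<^sub>Q\<^sub>S\<^sub>L\<^sub>w M (num m) (S (num n)) X \<^bold>\<rightarrow> num (m * n + m) \<^bold>= X"
    by (rule M_S_elim) simp
  from derivable_subst[OF this, of t vx] show ?case by (simp add: add.commute)
qed

subsection \<open>The order\<close>

lemma A_num_imp_eq_some_upto_if_S:
  assumes "T \<turnstile>\<^sub>Q\<^sub>S\<^sub>L\<^sub>w (A Z Y U \<^bold>\<and> num n \<^bold>= S U) \<^bold>\<rightarrow> eq_some_upto (S Y) n"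
  shows "T \<turnstile>\<^sub>Q\<^sub>S\<^sub>L\<^sub>w A Z X (num n) \<^bold>\<rightarrow> eq_some_upto X n"
proof (rule Zero_S_cases[of vx])
  have "T \<turnstile>\<^sub>Q\<^sub>S\<^sub>L\<^sub>w Zero \<^bold>= Zero \<^bold>\<rightarrow> eq_some_upto Zero n"
    using eq_some_uptoI[of 0 n T Zero] by simp
  from mp[OF eq_refl_tm this]
  show "T \<turnstile>\<^sub>Q\<^sub>S\<^sub>L\<^sub>w subst vx Zero (A Z X (num n) \<^bold>\<rightarrow> eq_some_upto X n)"
    by (simp add: imp_weaken)
  show "T \<turnstile>\<^sub>Q\<^sub>S\<^sub>L\<^sub>w subst vx (S Y) (A Z X (num n) \<^bold>\<rightarrow> eq_some_upto X n)"
    using A_S_elim[OF assms] by simp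
qed simp_all

lemma A_num_imp_eq_some_upto: "T \<turnstile>\<^sub>Q\<^sub>S\<^sub>L\<^sub>w A Z X (num n) \<^bold>\<rightarrow> eq_some_upto X n"
proof (induction n)
  case 0
  have "T \<turnstile>\<^sub>Q\<^sub>S\<^sub>L\<^sub>w (A Z Y U \<^bold>\<and> Zero \<^bold>= S U) \<^bold>\<rightarrow> \<^bold>\<bottom>"
    by (rule imp_trans[OF conjE2 imp_trans[OF eq_sym_tm S_neq_Zero]])
  from imp_trans[OF this bot] show ?case by (intro A_num_imp_eq_some_upto_if_S) simp
next
  case (Suc n)
  have "T \<turnstile>\<^sub>Q\<^sub>S\<^sub>L\<^sub>w A Z Y (num n) \<^bold>\<rightarrow> eq_some_upto Y n"
    using derivable_subst[OF Suc.IH, of Y vx] by simp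
  also have "T \<turnstile>\<^sub>Q\<^sub>S\<^sub>L\<^sub>w eq_some_upto Y n \<^bold>\<rightarrow> eq_some_upto (S Y) (Suc n)"
    by (rule eq_some_upto_S)
  finally have "T \<turnstile>\<^sub>Q\<^sub>S\<^sub>L\<^sub>w (S (num n) \<^bold>= S U \<^bold>\<and> A Z Y U) \<^bold>\<rightarrow> eq_some_upto (S Y) (Suc n)"
    by (intro conj_imp_if_eq[OF S_inject]) simp_all
  then have "T \<turnstile>\<^sub>Q\<^sub>S\<^sub>L\<^sub>w (A Z Y U \<^bold>\<and> S (num n) \<^bold>= S U) \<^bold>\<rightarrow> eq_some_upto (S Y) (Suc n)"
    by (rule imp_trans[OF imp_conjI[OF conjE2 conjE1]])
  then show ?case by (intro A_num_imp_eq_some_upto_if_S) simp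
qed

lemma num_Le_num:
  assumes "i \<le> n"
  shows "T \<turnstile>\<^sub>Q\<^sub>S\<^sub>L\<^sub>w num i \<^bold>\<le> num n"
proof -
  have "T \<turnstile>\<^sub>Q\<^sub>S\<^sub>L\<^sub>w A (num (n - i)) (num i) (num n)"
    using A_num[of "n - i" i] assms by simp
  from mp[OF this A_imp_Le] show ?thesis by simp
qed

lemma Le_num_iff: "T \<turnstile>\<^sub>Q\<^sub>S\<^sub>L\<^sub>w X \<^bold>\<le> num n \<^bold>\<leftrightarrow> eq_some_upto X n"
proof (rule adj)
  show "T \<turnstile>\<^sub>Q\<^sub>S\<^sub>L\<^sub>w X \<^bold>\<le> num n \<^bold>\<rightarrow> eq_some_upto X n"
    by (rule Le_elim[OF A_num_imp_eq_some_upto]) simp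
  show "T \<turnstile>\<^sub>Q\<^sub>S\<^sub>L\<^sub>w eq_some_upto X n \<^bold>\<rightarrow> X \<^bold>\<le> num n"
  proof (rule eq_some_uptoE)
    fix i assume "i \<le> n"
    then have "T \<turnstile>\<^sub>Q\<^sub>S\<^sub>L\<^sub>w num i \<^bold>= X \<^bold>\<rightarrow> X \<^bold>\<le> num n"
      by (intro eq_imp_if_subst) (simp_all add: num_Le_num)
    from imp_trans[OF eq_sym_tm this] show "T \<turnstile>\<^sub>Q\<^sub>S\<^sub>L\<^sub>w X \<^bold>= num i \<^bold>\<rightarrow> X \<^bold>\<le> num n" .
  qed
qed

lemma Le_num_decidable: "T \<turnstile>\<^sub>Q\<^sub>S\<^sub>L\<^sub>w X \<^bold>\<le> num n \<^bold>\<or> \<^bold>\<not> (X \<^bold>\<le> num n)"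
proof (rule decidable_iff[OF Le_num_iff])
  show "T \<turnstile>\<^sub>Q\<^sub>S\<^sub>L\<^sub>w eq_some_upto X n \<^bold>\<or> \<^bold>\<not> eq_some_upto X n"
    by (induction n) (auto intro: eq_decidable decidable_disj)
qed

lemma Le_num_Suc: "T \<turnstile>\<^sub>Q\<^sub>S\<^sub>L\<^sub>w X \<^bold>\<le> num n \<^bold>\<rightarrow> X \<^bold>\<le> num (Suc n)"
proof -
  have "T \<turnstile>\<^sub>Q\<^sub>S\<^sub>L\<^sub>w X \<^bold>\<le> num n \<^bold>\<rightarrow> eq_some_upto X (Suc n)"
    using imp_disjI1[OF conjD1[OF Le_num_iff]] by simp
  from imp_trans[OF this conjD2[OF Le_num_iff]] show ?thesis .
qed

lemma A_S_shift: "T \<turnstile>\<^sub>Q\<^sub>S\<^sub>L\<^sub>w A (S Y) (num n) X \<^bold>\<rightarrow> A Y (S (num n)) X"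
proof (induction n)
  case 0
  have "T \<turnstile>\<^sub>Q\<^sub>S\<^sub>L\<^sub>w A Y Zero Y" by (rule mp[OF eq_refl_tm conjD2[OF A_Zero_iff]])
  have "T \<turnstile>\<^sub>Q\<^sub>S\<^sub>L\<^sub>w A (S Y) Zero X \<^bold>\<rightarrow> S Y \<^bold>= X" by (rule conjD1[OF A_Zero_iff])
  also have "T \<turnstile>\<^sub>Q\<^sub>S\<^sub>L\<^sub>w S Y \<^bold>= X \<^bold>\<rightarrow> (A Y Zero Y \<^bold>\<and> X \<^bold>= S Y)"
    by (rule imp_conjI[OF imp_weaken[OF \<open>T \<turnstile>\<^sub>Q\<^sub>S\<^sub>L\<^sub>w A Y Zero Y\<close>] eq_sym_tm])
  also have "T \<turnstile>\<^sub>Q\<^sub>S\<^sub>L\<^sub>w (A Y Zero Y \<^bold>\<and> X \<^bold>= S Y) \<^bold>\<rightarrow> A Y (S Zero) X"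
    by (rule A_S_intro) simp
  finally show ?case by simp
next
  case (Suc n)
  have "T \<turnstile>\<^sub>Q\<^sub>S\<^sub>L\<^sub>w A (S Y) (num n) U \<^bold>\<rightarrow> A Y (S (num n)) U"
    using derivable_subst[OF Suc.IH, of U vx] by simp
  then have "T \<turnstile>\<^sub>Q\<^sub>S\<^sub>L\<^sub>w (A (S Y) (num n) U \<^bold>\<and> X \<^bold>= S U) \<^bold>\<rightarrow> (A Y (S (num n)) U \<^bold>\<and> X \<^bold>= S U)"
    by (rule imp_conjI[OF imp_trans[OF conjE1] conjE2])
  also have "T \<turnstile>\<^sub>Q\<^sub>S\<^sub>L\<^sub>w (A Y (S (num n)) U \<^bold>\<and> X \<^bold>= S U) \<^bold>\<rightarrow> A Y (S (S (num n))) X"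
    by (rule A_S_intro) simp
  finally show ?case using A_S_elim by simp
qed

lemma num_Le_imp_Suc_comparable:
  "T \<turnstile>\<^sub>Q\<^sub>S\<^sub>L\<^sub>w num n \<^bold>\<le> X \<^bold>\<rightarrow> (X \<^bold>\<le> num (Suc n) \<^bold>\<or> num (Suc n) \<^bold>\<le> X)" (is "_ \<turnstile>\<^sub>Q\<^sub>S\<^sub>L\<^sub>w _ \<^bold>\<rightarrow> ?\<chi>")
proof (rule Le_elim)
  have "T \<turnstile>\<^sub>Q\<^sub>S\<^sub>L\<^sub>w A Zero (num n) X \<^bold>\<rightarrow> num n \<^bold>= X"
    using A_num_imp_eq[of 0 n X] by simp
  also have "T \<turnstile>\<^sub>Q\<^sub>S\<^sub>L\<^sub>w num n \<^bold>= X \<^bold>\<rightarrow> X \<^bold>\<le> num (Suc n)"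
    using num_Le_num[of n "Suc n"] by (intro eq_imp_if_subst) simp_all
  finally have zero: "T \<turnstile>\<^sub>Q\<^sub>S\<^sub>L\<^sub>w A Zero (num n) X \<^bold>\<rightarrow> ?\<chi>"
    by (rule imp_disjI1)
  have "T \<turnstile>\<^sub>Q\<^sub>S\<^sub>L\<^sub>w A (S Y) (num n) X \<^bold>\<rightarrow> num (Suc n) \<^bold>\<le> X"
    using imp_trans[OF A_S_shift A_imp_Le] by simp
  then have succ: "T \<turnstile>\<^sub>Q\<^sub>S\<^sub>L\<^sub>w A (S Y) (num n) X \<^bold>\<rightarrow> ?\<chi>"
    by (rule imp_disjI2)
  show "T \<turnstile>\<^sub>Q\<^sub>S\<^sub>L\<^sub>w A Z (num n) X \<^bold>\<rightarrow> ?\<chi>"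
    by (rule Zero_S_cases[of vz]) (use zero succ in simp_all)
qed simp

lemma Le_num_linear: "T \<turnstile>\<^sub>Q\<^sub>S\<^sub>L\<^sub>w X \<^bold>\<le> num n \<^bold>\<or> num n \<^bold>\<le> X"
proof (induction n)
  case 0
  have "T \<turnstile>\<^sub>Q\<^sub>S\<^sub>L\<^sub>w A X Zero X" by (rule mp[OF eq_refl_tm conjD2[OF A_Zero_iff]])
  then have "T \<turnstile>\<^sub>Q\<^sub>S\<^sub>L\<^sub>w Zero \<^bold>\<le> X" by (rule mp[OF _ A_imp_Le]) simp
  from mp[OF this disjI2] show ?case by simp
next
  case (Suc n)
  from disj_cases[OF Suc.IH imp_disjI1[OF Le_num_Suc] num_Le_imp_Suc_comparable] show ?case .
qed

end

section \<open>The two theories\<close>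

interpretation Q_sim: Q_sim_extension Q_sim
  by unfold_locales (simp add: Q_sim_def)

interpretation Q_sim_printed: Q_sim_extension Q_sim_printed
  by unfold_locales (simp add: Q_sim_printed_def)

lemma Q_sim_M_num: "Q_sim \<turnstile>\<^sub>Q\<^sub>S\<^sub>L\<^sub>w M (num m) (num n) (num (m * n))"
proof (induction n)
  case 0
  show ?case using mp[OF eq_refl_tm conjD2[OF Q_sim.M_Zero_iff]] by simp
next
  case (Suc n)
  have "Q_sim \<turnstile>\<^sub>Q\<^sub>S\<^sub>L\<^sub>w M (num m) (num n) U \<^bold>\<rightarrow> (A U (num m) X \<^bold>\<rightarrow> M (num m) (num (n + 1)) X)"
    by (rule hyp) (unfold Q_sim_def, blast)
  from derivable_inst[OF this, of "Var(vu := num (m * n), vx := num (m * n + m))"]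
  have "Q_sim \<turnstile>\<^sub>Q\<^sub>S\<^sub>L\<^sub>w M (num m) (num n) (num (m * n)) \<^bold>\<rightarrow>
      (A (num (m * n)) (num m) (num (m * n + m)) \<^bold>\<rightarrow> M (num m) (num (Suc n)) (num (m * n + m)))"
    by simp
  from mp[OF Q_sim.A_num mp[OF Suc.IH this]] show ?case by (simp add: add.commute)
qed

lemma Q_sim_M_num_iff: "Q_sim \<turnstile>\<^sub>Q\<^sub>S\<^sub>L\<^sub>w M (num m) (num n) X \<^bold>\<leftrightarrow> num (m * n) \<^bold>= X"
proof (rule adj[OF Q_sim.M_num_imp_eq])
  show "Q_sim \<turnstile>\<^sub>Q\<^sub>S\<^sub>L\<^sub>w num (m * n) \<^bold>= X \<^bold>\<rightarrow> M (num m) (num n) X"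
    by (rule eq_imp_if_subst) (simp_all add: Q_sim_M_num)
qed

lemma Q_sim_printed_inconsistent: "Q_sim_printed \<turnstile>\<^sub>Q\<^sub>S\<^sub>L\<^sub>w \<^bold>\<bottom>"
proof -
  have "Q_sim_printed \<turnstile>\<^sub>Q\<^sub>S\<^sub>L\<^sub>w
      M (num 1) (num 0) U \<^bold>\<rightarrow> (A U (num 0) X \<^bold>\<rightarrow> M (num 1) (num (0 + 1)) X)"
    by (rule hyp) (unfold Q_sim_printed_def, blast)
  from derivable_inst[OF this, of "Var(vu := Zero, vx := Zero)"]
  have "Q_sim_printed \<turnstile>\<^sub>Q\<^sub>S\<^sub>L\<^sub>w M (num 1) Zero Zero \<^bold>\<rightarrow> (A Zero Zero Zero \<^bold>\<rightarrow> M (num 1) (num 1) Zero)"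
    by simp
  moreover have "Q_sim_printed \<turnstile>\<^sub>Q\<^sub>S\<^sub>L\<^sub>w M (num 1) Zero Zero"
    by (rule mp[OF eq_refl_tm conjD2[OF Q_sim_printed.M_Zero_iff]])
  moreover have "Q_sim_printed \<turnstile>\<^sub>Q\<^sub>S\<^sub>L\<^sub>w A Zero Zero Zero"
    by (rule mp[OF eq_refl_tm conjD2[OF Q_sim_printed.A_Zero_iff]])
  ultimately have "Q_sim_printed \<turnstile>\<^sub>Q\<^sub>S\<^sub>L\<^sub>w M (num 1) (num 1) Zero" using mp by blast
  from mp[OF this Q_sim_printed.M_num_imp_eq]
  have "Q_sim_printed \<turnstile>\<^sub>Q\<^sub>S\<^sub>L\<^sub>w num (Suc 0) \<^bold>= num 0" by simp
  from mp[OF this Q_sim_printed.num_neq_num] show ?thesis by simp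
qed

theorem mainTheorem3:
  shows "(\<forall>\<phi> \<in> R_sim. Q_sim_printed \<turnstile>\<^sub>Q\<^sub>S\<^sub>L\<^sub>w \<phi>) \<and> (\<forall>\<phi> \<in> R_sim. Q_sim \<turnstile>\<^sub>Q\<^sub>S\<^sub>L\<^sub>w \<phi>)"
proof (intro conjI ballI)
  show "Q_sim_printed \<turnstile>\<^sub>Q\<^sub>S\<^sub>L\<^sub>w \<phi>" for \<phi>
    by (rule mp[OF Q_sim_printed_inconsistent bot])
  show "Q_sim \<turnstile>\<^sub>Q\<^sub>S\<^sub>L\<^sub>w \<phi>" if "\<phi> \<in> R_sim" for \<phi>
    using that unfolding R_sim_def
    by (auto intro: Q_sim.A_num_iff Q_sim_M_num_iff Q_sim.num_neq_num Q_sim.Le_num_iff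
        Q_sim.Le_num_linear Q_sim.Le_num_decidable)
qed

end
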